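(* Let $\alpha>-1$. For $t>0$ the recurrence coefficients $\alpha_n(t)$ and $\beta_n(t)$ satisfy the system of differential-difference equations $$t\,\alpha_n'(t)=\alpha_n(t)+\beta_n(t)-\beta_{n+1}(t)\quad (n\ge0),$$ $$t\,\beta_n'(t)=\beta_n(t)\left(\alpha_{n-1}(t)-\alpha_n(t)+2\right)\quad (n\ge1),$$ where $'$ denotes $\frac{d}{dt}$.
   Context: For $\alpha>-1$, $t\ge0$, let $w(x;t,\alpha)=x^\alpha e^{-x-t/x}$ on $(0,\infty)$, and let $P_n(x;t,\alpha)$, $n=0,1,2,\dots$, be the monic orthogonal polynomials of degree $n$ with respect to $w$: $\int_0^\infty P_jP_kw\,dx=h_j\delta_{jk}$, $h_j>0$. The recurrence coefficients $\alpha_n(t)$, $\beta_n(t)$ (depending also on the fixed parameter $\alpha$, with which $\alpha_n$ should not be confused) are defined by $xP_n=P_{n+1}+\alpha_nP_n+\beta_nP_{n-1}$ with $P_0=1$, $\beta_0=0$ (i.e. $\beta_0P_{-1}=0$). *)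

theory Defs
  imports "HOL-Analysis.Analysis" "HOL-Computational_Algebra.Polynomial"
begin

definition weight :: "real \<Rightarrow> real \<Rightarrow> real \<Rightarrow> real" where
  "weight \<alpha> t x = x powr \<alpha> * exp (- x - t / x)"

(* For \<alpha> > -1 and t \<ge> 0 all integrands below are Lebesgue integrable on (0, \<infinity>),
   so the default value 0 of the integral of a non-integrable function plays no role. *)
definition monic_orthogonal_polys :: "real \<Rightarrow> real \<Rightarrow> (nat \<Rightarrow> real poly) \<Rightarrow> bool" where
  "monic_orthogonal_polys \<alpha> t P \<longleftrightarrow>
     (\<forall>n. degree (P n) = n \<and> lead_coeff (P n) = 1) \<and>
     (\<exists>h :: nat \<Rightarrow> real. \<forall>j. h j > 0 \<and>
        (\<forall>k. (LBINT x:{0<..}. poly (P j) x * poly (P k) x * weight \<alpha> t x)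
             = (if j = k then h j else 0)))"

(* At n = 0 the truncated index n - 1 = 0 is harmless: that term is multiplied by b 0 = 0,
   which encodes the convention \<beta>_0 P_{-1} = 0. *)
definition recurrence_coeffs ::
    "(nat \<Rightarrow> real poly) \<Rightarrow> (nat \<Rightarrow> real) \<Rightarrow> (nat \<Rightarrow> real) \<Rightarrow> bool" where
  "recurrence_coeffs P a b \<longleftrightarrow>
     P 0 = 1 \<and> b 0 = 0 \<and>
     (\<forall>n. [:0, 1:] * P n = P (n + 1) + smult (a n) (P n) + smult (b n) (P (n - 1)))"

end

(*
  Write L_t(p) for the integral of p w over (0, oo). Differentiating under the integral sign and
  integrating by parts gives, for every polynomial p independent of t,
    t d/dt L_t(p) = L_t(x p' + (1 + alpha) p - x p).
  Since a_n = L_t(x P_n^2) / h_n and b_n = h_n / h_(n-1), the recurrence shows by induction on n that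
  the coefficients of P_n are differentiable in t. Applying the identity (plus the term coming from
  the t-dependence of p) to p = P_n^2 and using orthogonality yields
    t h_n' = (2 n + 1 + alpha - a_n) h_n,
  hence the equation for b_n = h_n / h_(n-1). Applying it to p = P_n P_(n-1), on which L_t vanishes
  identically, yields t p_n' = p_n + b_n for the subleading coefficient p_n of P_n, hence the
  equation for a_n = p_n - p_(n+1).
*)

theory Submission
  imports Defs "HOL-Real_Asymp.Real_Asymp"
begin

section \<open>Moments of the weight\<close>

lemma weight_measurable [measurable]: "weight \<alpha> t \<in> borel_measurable borel"
  unfolding weight_def by measurable

lemma weight_pos: "x > 0 \<Longrightarrow> weight \<alpha> t x > 0"
  by (simp add: weight_def)

lemma power_weight:
  assumes "x > 0"
  shows "x ^ k * weight \<alpha> t x = x powr (real k + \<alpha>) * exp (- x - t / x)"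
  using assms by (simp add: weight_def powr_add powr_realpow)

text \<open>Obtained from the absolutely convergent complex Gamma integral at \<open>s + 1\<close>:
  the norm of its integrand is the real integrand here. Borel measurability allows passing from the
  completed measure to \<open>lborel\<close>.\<close>

lemma set_integrable_Gamma:
  fixes s :: real
  assumes "s > -1"
  shows "set_integrable lborel {0<..} (\<lambda>x. x powr s * exp (- x))"
proof -
  have "(\<lambda>x. norm (complex_of_real x powr (complex_of_real (s + 1) - 1) / of_real (exp x)))
          absolutely_integrable_on {0<..}"
    using absolutely_integrable_norm[OF absolutely_integrable_Gamma_integral'[of "complex_of_real (s + 1)"]] assms
    by (simp add: o_def)
  then have "set_integrable lebesgue {0<..} (\<lambda>x. x powr s * exp (- x))"
    by (rule set_integrable_cong[THEN iffD1, rotated -1])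
       (auto simp: norm_divide norm_powr_real_powr exp_minus field_simps)
  then show ?thesis
    unfolding set_integrable_def by (subst (asm) integrable_completion) auto
qed

lemma set_integrable_power_weight:
  assumes "\<alpha> > -1" "t \<ge> 0"
  shows "set_integrable lborel {0<..} (\<lambda>x. x ^ k * weight \<alpha> t x)"
proof (rule set_integrable_bound)
  show "set_integrable lborel {0<..} (\<lambda>x. x powr (real k + \<alpha>) * exp (- x))"
    by (rule set_integrable_Gamma) (use assms in linarith)
  show "set_borel_measurable lborel {0<..} (\<lambda>x. x ^ k * weight \<alpha> t x)"
    unfolding set_borel_measurable_def by measurable
  show "AE x in lborel. x \<in> {0<..} \<longrightarrow>
     norm (x ^ k * weight \<alpha> t x) \<le> norm (x powr (real k + \<alpha>) * exp (- x))"
    using assms by (auto simp: power_weight abs_mult intro!: AE_I2 mult_left_mono)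
qed

text \<open>Applied with \<open>u = t / x\<close>, so that \<open>exp (- t / x) / x\<close> is at
  most \<open>1 / t\<close>.\<close>

lemma exp_minus_le_inverse:
  fixes u :: real
  assumes "u > 0"
  shows "exp (- u) \<le> 1 / u"
proof -
  have "u \<le> exp u"
    using exp_ge_add_one_self[of u] by linarith
  then show ?thesis
    using assms by (simp add: exp_minus field_simps)
qed

text \<open>The extra factor \<open>1 / x\<close> can destroy integrability at 0 (for
  \<open>k = 0\<close> and \<open>\<alpha> \<le> 0\<close>) unless \<open>exp (- t / x)\<close>
  compensates it, which requires \<open>t > 0\<close>.\<close>

lemma set_integrable_power_weight_divide:
  assumes "\<alpha> > -1" "t > 0"
  shows "set_integrable lborel {0<..} (\<lambda>x. x ^ k * weight \<alpha> t x / x)"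
proof (rule set_integrable_bound)
  show "set_integrable lborel {0<..} (\<lambda>x. 1 / t * (x powr (real k + \<alpha>) * exp (- x)))"
    by (intro set_integrable_mult_right set_integrable_Gamma) (use assms in linarith)
  show "set_borel_measurable lborel {0<..} (\<lambda>x. x ^ k * weight \<alpha> t x / x)"
    unfolding set_borel_measurable_def by measurable
  have "norm (x ^ k * weight \<alpha> t x / x) \<le> norm (1 / t * (x powr (real k + \<alpha>) * exp (- x)))"
    if "x > 0" for x
  proof -
    have "exp (- (t / x)) / x \<le> 1 / t"
      using exp_minus_le_inverse[of "t / x"] that assms by (simp add: field_simps)
    then have "x powr (real k + \<alpha>) * exp (- x) * (exp (- (t / x)) / x)
        \<le> x powr (real k + \<alpha>) * exp (- x) * (1 / t)"
      by (intro mult_left_mono) auto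
    then show ?thesis
      using that assms by (simp add: power_weight abs_mult mult_ac exp_diff exp_minus divide_inverse)
  qed
  then show "AE x in lborel. x \<in> {0<..} \<longrightarrow>
     norm (x ^ k * weight \<alpha> t x / x) \<le> norm (1 / t * (x powr (real k + \<alpha>) * exp (- x)))"
    by (auto intro!: AE_I2)
qed

section \<open>Moments as functions of time\<close>

definition moment :: "real \<Rightarrow> real \<Rightarrow> nat \<Rightarrow> real" where
  "moment \<alpha> t k = (LBINT x:{0<..}. x ^ k * weight \<alpha> t x)"

lemma has_real_derivative_weight_time:
  assumes "x \<noteq> 0"
  shows "((\<lambda>s. weight \<alpha> s x) has_real_derivative - (weight \<alpha> t x / x)) (at t)"
  using assms unfolding weight_def by (auto intro!: derivative_eq_intros)

text \<open>By the mean value theorem the quotient is a time derivative at an intermediate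
  \<open>z\<close>; since the weight decreases in time, the value at \<open>c\<close> bounds it. The
  bound does not depend on \<open>s\<close>, as dominated convergence demands.\<close>

lemma weight_difference_quotient_le:
  assumes "x > 0" "s \<ge> c" "t \<ge> c" "s \<noteq> t"
  shows "\<bar>(weight \<alpha> s x - weight \<alpha> t x) / (s - t)\<bar> \<le> weight \<alpha> c x / x"
proof -
  have *: "\<bar>(weight \<alpha> u x - weight \<alpha> v x) / (u - v)\<bar> \<le> weight \<alpha> c x / x"
    if uv: "c \<le> v" "v < u" for u v
  proof -
    obtain z where z: "v < z" "z < u"
      "weight \<alpha> u x - weight \<alpha> v x = (u - v) * (- (weight \<alpha> z x / x))"
      using MVT2[OF uv(2), of "\<lambda>s. weight \<alpha> s x" "\<lambda>s. - (weight \<alpha> s x / x)"]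
        has_real_derivative_weight_time[of x] assms(1) by auto
    have "weight \<alpha> z x \<le> weight \<alpha> c x"
      using assms(1) uv z by (auto simp: weight_def divide_right_mono intro!: mult_left_mono)
    then show ?thesis
      using z uv assms(1) weight_pos[OF assms(1), of \<alpha> z] by (simp add: divide_right_mono)
  qed
  show ?thesis
  proof (cases "t < s")
    case True
    then show ?thesis using * assms by blast
  next
    case False
    then have "t > s" using assms by simp
    then have "\<bar>(weight \<alpha> t x - weight \<alpha> s x) / (t - s)\<bar> \<le> weight \<alpha> c x / x"
      using * assms by blast
    then show ?thesis
      by (simp add: abs_minus_commute)
  qed
qed

lemma moment_has_derivative:
  assumes "\<alpha> > -1" "t > 0"
  shows "((\<lambda>s. moment \<alpha> s k) has_real_derivative
           - (LBINT x:{0<..}. x ^ k * weight \<alpha> t x / x)) (at t)"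
proof -
  define q where "q s x = x ^ k * ((weight \<alpha> s x - weight \<alpha> t x) / (s - t))" for s x
  have quot: "(moment \<alpha> s k - moment \<alpha> t k) / (s - t) = (LBINT x:{0<..}. q s x)" if "s > 0" for s
  proof -
    have "moment \<alpha> s k - moment \<alpha> t k
        = (LBINT x:{0<..}. x ^ k * weight \<alpha> s x - x ^ k * weight \<alpha> t x)"
      unfolding moment_def using assms that
      by (subst set_integral_diff(2)) (auto intro!: set_integrable_power_weight)
    then show ?thesis
      by (simp add: q_def algebra_simps flip: set_integral_divide_zero)
  qed
  \<comment> \<open>Staying above \<open>t/2\<close>, a neighbourhood of \<open>t\<close> away from
    0, lets the single integrable function for time \<open>t/2\<close> dominate all
    quotients.\<close>
  have "(\<lambda>n. LBINT x:{0<..}. q (X n) x) \<longlonglongrightarrow> (LBINT x:{0<..}. - (x ^ k * weight \<alpha> t x / x))"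
    if X: "\<And>n. X n \<in> {t/2<..} - {t}" "X \<longlonglongrightarrow> t" for X
    unfolding set_lebesgue_integral_def
  proof (rule integral_dominated_convergence)
    show "integrable lborel (\<lambda>x. indicator {0<..} x *\<^sub>R (x ^ k * weight \<alpha> (t/2) x / x))"
      using set_integrable_power_weight_divide[of \<alpha> "t/2" k] assms
      unfolding set_integrable_def by simp
    show "AE x in lborel. (\<lambda>n. indicat_real {0<..} x *\<^sub>R q (X n) x)
            \<longlonglongrightarrow> indicat_real {0<..} x *\<^sub>R - (x ^ k * weight \<alpha> t x / x)"
    proof (rule AE_I2)
      fix x :: real
      show "(\<lambda>n. indicat_real {0<..} x *\<^sub>R q (X n) x)
            \<longlonglongrightarrow> indicat_real {0<..} x *\<^sub>R - (x ^ k * weight \<alpha> t x / x)"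
      proof (cases "x > 0")
        case True
        then have "((\<lambda>s. (weight \<alpha> s x - weight \<alpha> t x) / (s - t)) \<longlongrightarrow> - (weight \<alpha> t x / x)) (at t)"
          using has_real_derivative_weight_time[of x \<alpha> t] by (simp add: has_field_derivative_iff)
        then have "(\<lambda>n. (weight \<alpha> (X n) x - weight \<alpha> t x) / (X n - t)) \<longlonglongrightarrow> - (weight \<alpha> t x / x)"
          using X unfolding tendsto_at_iff_sequentially o_def by blast
        from tendsto_mult_left[OF this, of "x ^ k"] True show ?thesis
          by (simp add: q_def)
      qed simp
    qed
    show "AE x in lborel. norm (indicat_real {0<..} x *\<^sub>R q (X n) x)
            \<le> indicat_real {0<..} x *\<^sub>R (x ^ k * weight \<alpha> (t/2) x / x)" for n
    proof (rule AE_I2)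
      fix x :: real
      show "norm (indicat_real {0<..} x *\<^sub>R q (X n) x)
            \<le> indicat_real {0<..} x *\<^sub>R (x ^ k * weight \<alpha> (t/2) x / x)"
      proof (cases "x > 0")
        case True
        have "\<bar>(weight \<alpha> (X n) x - weight \<alpha> t x) / (X n - t)\<bar> \<le> weight \<alpha> (t/2) x / x"
          using X(1)[of n] assms True by (intro weight_difference_quotient_le) auto
        from mult_left_mono[OF this, of "x ^ k"] show ?thesis
          using True by (simp add: q_def abs_mult)
      qed simp
    qed
  qed (simp_all add: q_def)
  then have "((\<lambda>s. LBINT x:{0<..}. q s x) \<longlongrightarrow> (LBINT x:{0<..}. - (x ^ k * weight \<alpha> t x / x)))
               (at t within {t/2<..})"
    unfolding tendsto_at_iff_sequentially o_def by blast
  then have "((\<lambda>s. (moment \<alpha> s k - moment \<alpha> t k) / (s - t))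
      \<longlongrightarrow> (LBINT x:{0<..}. - (x ^ k * weight \<alpha> t x / x))) (at t within {t/2<..})"
    by (rule Lim_transform_eventually)
       (use assms in \<open>auto simp: eventually_at_filter quot intro!: always_eventually\<close>)
  then show ?thesis
    using assms by (simp add: has_field_derivative_iff at_within_open[of t "{t/2<..}"] set_integral_uminus set_integrable_power_weight_divide)
qed

text \<open>The derivative of x^(k+1) w integrates to 0, its boundary values being 0. This trades
  the \<open>1 / x\<close> integral in the time derivative for moments.\<close>

lemma moment_integration_by_parts:
  assumes "\<alpha> > -1" "t > 0"
  shows "t * (LBINT x:{0<..}. x ^ k * weight \<alpha> t x / x)
           = moment \<alpha> t (k + 1) - (real k + 1 + \<alpha>) * moment \<alpha> t k"
proof -
  \<comment> \<open>\<open>f\<close> is the derivative of \<open>F\<close> below, split into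
    separately integrable terms.\<close>
  define f where "f x = (real k + 1 + \<alpha>) * (x ^ k * weight \<alpha> t x) - x ^ (k + 1) * weight \<alpha> t x
    + t * (x ^ k * weight \<alpha> t x / x)" for x
  have ints: "set_integrable lborel {0<..} (\<lambda>x. (real k + 1 + \<alpha>) * (x ^ k * weight \<alpha> t x))"
    "set_integrable lborel {0<..} (\<lambda>x. x ^ (k + 1) * weight \<alpha> t x)"
    "set_integrable lborel {0<..} (\<lambda>x. t * (x ^ k * weight \<alpha> t x / x))"
    using assms by (intro set_integrable_mult_right set_integrable_power_weight
        set_integrable_power_weight_divide; simp)+
  have "set_integrable lborel {0<..} (\<lambda>x. (real k + 1 + \<alpha>) * (x ^ k * weight \<alpha> t x)
      - x ^ (k + 1) * weight \<alpha> t x)"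
    using ints by (intro set_integral_diff(1))
  note ints = ints this
  have int: "set_integrable lborel {0<..} f"
    unfolding f_def using ints by (intro set_integral_add(1))
  \<comment> \<open>\<open>F\<close> is \<open>x ^ (k + 1) * weight \<alpha> t x\<close> on the
    positive axis, with the powers merged; it tends to 0 at both ends.\<close>
  define F where "F x = x powr (real k + 1 + \<alpha>) * exp (- x - t / x)" for x
  have pos: "real k + 1 + \<alpha> > 0" using assms by linarith
  have "(LBINT x=ereal 0..\<infinity>. f x) = 0 - 0"
  proof (rule interval_integral_FTC_integrable)
    show "(F has_vector_derivative f x) (at x)" if "ereal 0 < ereal x" for x
    proof -
      have x: "x > 0" using that by simp
      have "((\<lambda>x. exp (- x - t / x)) has_real_derivative exp (- x - t / x) * (t / x\<^sup>2 - 1)) (at x)"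
        using x by (auto intro!: derivative_eq_intros simp: power2_eq_square)
      from DERIV_mult[OF has_real_derivative_powr[OF x] this, of "real k + 1 + \<alpha>"]
      have "(F has_real_derivative (real k + 1 + \<alpha>) * x powr (real k + 1 + \<alpha> - 1) * exp (- x - t / x)
          + exp (- x - t / x) * (t / x\<^sup>2 - 1) * x powr (real k + 1 + \<alpha>)) (at x)"
        unfolding F_def .
      also have "(real k + 1 + \<alpha>) * x powr (real k + 1 + \<alpha> - 1) * exp (- x - t / x)
          + exp (- x - t / x) * (t / x\<^sup>2 - 1) * x powr (real k + 1 + \<alpha>) = f x"
        using x by (simp add: f_def weight_def powr_add powr_diff powr_realpow field_simps power2_eq_square)
      finally have "(F has_real_derivative f x) (at x)" .
      then show ?thesis
        by (simp add: has_real_derivative_iff_has_vector_derivative)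
    qed
    show "isCont f x" if "ereal 0 < ereal x" for x
      using that unfolding f_def weight_def by (auto intro!: continuous_intros)
    show "set_integrable lborel (einterval (ereal 0) \<infinity>) f"
      using int by simp
    have "(F \<longlongrightarrow> 0) (at_right 0)"
      unfolding F_def using pos assms(2) by real_asymp
    then show "((F \<circ> real_of_ereal) \<longlongrightarrow> 0) (at_right (ereal 0))"
      by (simp add: ereal_tendsto_simps)
    have "(F \<longlongrightarrow> 0) at_top"
      unfolding F_def using pos assms(2) by real_asymp
    then show "((F \<circ> real_of_ereal) \<longlongrightarrow> 0) (at_left \<infinity>)"
      by (simp add: ereal_tendsto_simps)
  qed auto
  then have "(LBINT x:{0<..}. f x) = 0"
    by (simp add: interval_integral_to_infinity_eq)
  moreover have "(LBINT x:{0<..}. f x) = (real k + 1 + \<alpha>) * moment \<alpha> t k - moment \<alpha> t (k + 1)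
      + t * (LBINT x:{0<..}. x ^ k * weight \<alpha> t x / x)"
    unfolding f_def moment_def using ints
    by (simp only: set_integral_add(2) set_integral_diff(2) set_integral_mult_right)
  ultimately show ?thesis by simp
qed

section \<open>Differentiating the functional along a family of polynomials\<close>

definition weight_functional :: "real \<Rightarrow> real \<Rightarrow> real poly \<Rightarrow> real" where
  "weight_functional \<alpha> t p = (LBINT x:{0<..}. poly p x * weight \<alpha> t x)"

text \<open>A bound \<open>N\<close> in place of the degree lets different polynomials, or one
  family at different times, share an index range.\<close>

lemma weight_functional_eq_sum:
  assumes "\<alpha> > -1" "t \<ge> 0" "degree p \<le> N"
  shows "weight_functional \<alpha> t p = (\<Sum>i\<le>N. coeff p i * moment \<alpha> t i)"
proof -
  have poly: "poly p x = (\<Sum>i\<le>N. coeff p i * x ^ i)" for x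
    unfolding poly_altdef using assms(3)
    by (intro sum.mono_neutral_left) (auto simp: coeff_eq_0)
  have "weight_functional \<alpha> t p
      = (\<integral>x. (\<Sum>i\<le>N. coeff p i * (indicator {0<..} x *\<^sub>R (x ^ i * weight \<alpha> t x))) \<partial>lborel)"
    unfolding weight_functional_def set_lebesgue_integral_def poly
    by (intro Bochner_Integration.integral_cong) (auto simp: sum_distrib_right sum_distrib_left mult_ac)
  also have "\<dots> = (\<Sum>i\<le>N. coeff p i * moment \<alpha> t i)"
    unfolding moment_def set_lebesgue_integral_def
    using set_integrable_power_weight[OF assms(1,2)] unfolding set_integrable_def
    by (subst Bochner_Integration.integral_sum) auto
  finally show ?thesis .
qed

lemma weight_functional_linear:
  assumes "\<alpha> > -1" "t \<ge> 0"
  shows weight_functional_add: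
      "weight_functional \<alpha> t (p + q) = weight_functional \<alpha> t p + weight_functional \<alpha> t q"
    and weight_functional_diff:
      "weight_functional \<alpha> t (p - q) = weight_functional \<alpha> t p - weight_functional \<alpha> t q"
    and weight_functional_smult:
      "weight_functional \<alpha> t (smult c p) = c * weight_functional \<alpha> t p"
proof -
  let ?N = "max (degree p) (degree q)"
  note eq = weight_functional_eq_sum[OF assms, of _ ?N]
  show "weight_functional \<alpha> t (p + q) = weight_functional \<alpha> t p + weight_functional \<alpha> t q"
    by (simp add: eq degree_add_le sum.distrib algebra_simps)
  show "weight_functional \<alpha> t (p - q) = weight_functional \<alpha> t p - weight_functional \<alpha> t q"
    by (simp add: eq degree_diff_le sum_subtractf algebra_simps)
  show "weight_functional \<alpha> t (smult c p) = c * weight_functional \<alpha> t p"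
    by (simp add: eq sum_distrib_left mult.assoc)
qed

section \<open>Coefficientwise time derivatives of families of polynomials\<close>

definition has_coeff_derivative :: "(real \<Rightarrow> real poly) \<Rightarrow> real poly \<Rightarrow> real \<Rightarrow> bool" where
  "has_coeff_derivative F D t \<longleftrightarrow>
     (\<forall>i. ((\<lambda>s. coeff (F s) i) has_real_derivative coeff D i) (at t))"

lemma has_coeff_derivative_const: "has_coeff_derivative (\<lambda>s. p) 0 t"
  by (simp add: has_coeff_derivative_def)

lemma has_coeff_derivative_diff:
  "has_coeff_derivative F D t \<Longrightarrow> has_coeff_derivative G E t \<Longrightarrow>
     has_coeff_derivative (\<lambda>s. F s - G s) (D - E) t"
  by (auto simp: has_coeff_derivative_def intro!: DERIV_diff)

lemma has_coeff_derivative_smult: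
  assumes "(c has_real_derivative c') (at t)" "has_coeff_derivative F D t"
  shows "has_coeff_derivative (\<lambda>s. smult (c s) (F s)) (smult c' (F t) + smult (c t) D) t"
  using assms DERIV_mult'[OF assms(1)]
  by (auto simp: has_coeff_derivative_def add.commute)

lemma has_coeff_derivative_pCons:
  assumes "has_coeff_derivative F D t"
  shows "has_coeff_derivative (\<lambda>s. pCons 0 (F s)) (pCons 0 D) t"
  using assms by (auto simp: has_coeff_derivative_def coeff_pCons split: nat.split)

lemma has_coeff_derivative_mult:
  assumes "has_coeff_derivative F D t" "has_coeff_derivative G E t"
  shows "has_coeff_derivative (\<lambda>s. F s * G s) (F t * E + D * G t) t"
  using assms
  by (auto simp: has_coeff_derivative_def coeff_mult sum.distrib[symmetric]
      intro!: DERIV_sum DERIV_mult')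

lemma has_coeff_derivative_transform:
  assumes "has_coeff_derivative F D t" "t \<in> S" "open S" "\<And>s. s \<in> S \<Longrightarrow> F s = G s"
  shows "has_coeff_derivative G D t"
  unfolding has_coeff_derivative_def
proof
  fix i
  show "((\<lambda>s. coeff (G s) i) has_real_derivative coeff D i) (at t)"
    by (rule has_field_derivative_transform_within_open[of "\<lambda>s. coeff (F s) i" _ _ S])
       (use assms in \<open>auto simp: has_coeff_derivative_def\<close>)
qed

text \<open>Serves to bound degrees: the derivative of a monic family of degree n has degree below
  n.\<close>

lemma has_coeff_derivative_coeff_eq_0:
  assumes "has_coeff_derivative F D t" "t \<in> S" "open S" "\<And>s. s \<in> S \<Longrightarrow> coeff (F s) i = c"
  shows "coeff D i = 0"
proof -
  have "((\<lambda>s. coeff (F s) i) has_real_derivative 0) (at t)"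
    by (rule has_field_derivative_transform_within_open[of "\<lambda>s. c" _ _ S]) (use assms in auto)
  then show ?thesis
    using assms(1) DERIV_unique unfolding has_coeff_derivative_def by blast
qed

text \<open>The operator taking p to x p' is diagonal on monomials; through it the factor
  \<open>real k\<close> in \<open>moment_integration_by_parts\<close> becomes an operation on
  polynomials.\<close>

lemma coeff_pCons_pderiv: "coeff (pCons 0 (pderiv p)) i = of_nat i * coeff p i"
  by (cases i) (auto simp: coeff_pderiv)

text \<open>Product rule on the expansion into moments: \<open>D\<close> collects the derivatives of
  the coefficients, the quotient by \<open>t\<close> those of the moments. Here
  \<open>pCons 0\<close> is multiplication by x.\<close>

lemma weight_functional_has_derivative:
  assumes \<alpha>: "\<alpha> > -1" and t: "t > 0"
    and F: "has_coeff_derivative F D t" and N: "\<And>s. s > 0 \<Longrightarrow> degree (F s) \<le> N"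
  shows "((\<lambda>s. weight_functional \<alpha> s (F s)) has_real_derivative
     weight_functional \<alpha> t D + (weight_functional \<alpha> t (pCons 0 (pderiv (F t)))
       + (1 + \<alpha>) * weight_functional \<alpha> t (F t) - weight_functional \<alpha> t (pCons 0 (F t))) / t) (at t)"
proof -
  \<comment> \<open>The derivative of the i-th moment, with the \<open>1 / x\<close> integral
    eliminated by parts.\<close>
  define m' where "m' i = ((real i + 1 + \<alpha>) * moment \<alpha> t i - moment \<alpha> t (i + 1)) / t" for i
  have m': "((\<lambda>s. moment \<alpha> s i) has_real_derivative m' i) (at t)" for i
  proof -
    have "m' i = - (LBINT x:{0<..}. x ^ i * weight \<alpha> t x / x)"
      using moment_integration_by_parts[OF \<alpha> t, of i] t by (simp add: m'_def field_simps)
    then show ?thesis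
      using moment_has_derivative[OF \<alpha> t] by simp
  qed
  have t0: "t \<ge> 0" using t by simp
  have "coeff D i = 0" if "i > N" for i
  proof (rule has_coeff_derivative_coeff_eq_0[OF F, of "{0<..}" i 0])
    show "coeff (F s) i = 0" if "s \<in> {0<..}" for s
      using N[of s] that \<open>i > N\<close> by (intro coeff_eq_0) auto
  qed (use t in auto)
  then have D: "degree D \<le> N"
    by (meson degree_le)
  have "((\<lambda>s. \<Sum>i\<le>N. coeff (F s) i * moment \<alpha> s i) has_real_derivative
      (\<Sum>i\<le>N. coeff D i * moment \<alpha> t i + m' i * coeff (F t) i)) (at t)"
    using F m' by (intro DERIV_sum DERIV_mult) (auto simp: has_coeff_derivative_def)
  then have "((\<lambda>s. weight_functional \<alpha> s (F s)) has_real_derivative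
      (\<Sum>i\<le>N. coeff D i * moment \<alpha> t i + m' i * coeff (F t) i)) (at t)"
    by (rule has_field_derivative_transform_within_open[of _ _ _ "{0<..}"])
       (use \<alpha> t N weight_functional_eq_sum[of \<alpha> _ _ N] in auto)
  also have "(\<Sum>i\<le>N. coeff D i * moment \<alpha> t i + m' i * coeff (F t) i)
      = weight_functional \<alpha> t D + (\<Sum>i\<le>N. m' i * coeff (F t) i)"
    using weight_functional_eq_sum[OF \<alpha> t0 D] by (simp add: sum.distrib)
  also have "(\<Sum>i\<le>N. m' i * coeff (F t) i)
      = ((\<Sum>i\<le>N. coeff (pCons 0 (pderiv (F t))) i * moment \<alpha> t i)
        + (1 + \<alpha>) * (\<Sum>i\<le>N. coeff (F t) i * moment \<alpha> t i)
        - (\<Sum>i\<le>N. coeff (F t) i * moment \<alpha> t (Suc i))) / t"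
    unfolding coeff_pCons_pderiv
    by (simp add: m'_def sum_distrib_left sum_divide_distrib flip: sum.distrib sum_subtractf)
       (intro sum.cong refl, simp add: field_simps)
  also have "(\<Sum>i\<le>N. coeff (pCons 0 (pderiv (F t))) i * moment \<alpha> t i)
      = weight_functional \<alpha> t (pCons 0 (pderiv (F t)))"
  proof -
    have "degree (pCons 0 (pderiv (F t))) \<le> N"
      using N[OF t] by (cases "degree (F t) = 0") (auto simp: degree_pderiv pderiv_eq_0_iff)
    then show ?thesis
      using weight_functional_eq_sum[OF \<alpha> t0] by simp
  qed
  also have "(\<Sum>i\<le>N. coeff (F t) i * moment \<alpha> t i) = weight_functional \<alpha> t (F t)"
    using weight_functional_eq_sum[OF \<alpha> t0 N[OF t]] by simp
  also have "(\<Sum>i\<le>N. coeff (F t) i * moment \<alpha> t (Suc i)) = weight_functional \<alpha> t (pCons 0 (F t))"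
  proof -
    \<comment> \<open>Multiplication by x raises the degree bound by one; the new constant
      coefficient is 0, so the sum up to \<open>Suc N\<close> shifts to one up to
      \<open>N\<close>.\<close>
    have "degree (pCons 0 (F t)) \<le> Suc N"
      using N[OF t] by (metis degree_pCons_le le_trans Suc_le_mono)
    from weight_functional_eq_sum[OF \<alpha> t0 this] show ?thesis
      by (simp add: sum.atMost_Suc_shift del: sum.atMost_Suc)
  qed
  finally show ?thesis .
qed

section \<open>The orthogonal polynomials\<close>

text \<open>No regularity in time is assumed of \<open>P\<close>, \<open>a\<close> and
  \<open>b\<close>; their differentiability is derived in \<open>P_differentiable\<close> and the
  lemmas around it.\<close>

locale recurrence_flow =
  fixes \<alpha> :: real and P :: "nat \<Rightarrow> real \<Rightarrow> real poly" and a b :: "nat \<Rightarrow> real \<Rightarrow> real"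
  assumes alpha: "\<alpha> > -1"
    and orthogonal: "\<And>t. t > 0 \<Longrightarrow> monic_orthogonal_polys \<alpha> t (\<lambda>n. P n t)"
    and recurrence: "\<And>t. t > 0 \<Longrightarrow> recurrence_coeffs (\<lambda>n. P n t) (\<lambda>n. a n t) (\<lambda>n. b n t)"
begin

abbreviation L :: "real \<Rightarrow> real poly \<Rightarrow> real" where
  "L \<equiv> weight_functional \<alpha>"

text \<open>For positive times this is the existentially quantified norm constant of
  \<open>monic_orthogonal_polys\<close>, made explicit so that it can be differentiated.\<close>

definition h :: "nat \<Rightarrow> real \<Rightarrow> real" where
  "h n t = L t (P n t * P n t)"

section \<open>Consequences of orthogonality at a fixed time\<close>

lemmas L_linear = weight_functional_linear[OF alpha less_imp_le]

lemma degree_P: "t > 0 \<Longrightarrow> degree (P n t) = n"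
  and coeff_P_self: "t > 0 \<Longrightarrow> coeff (P n t) n = 1"
  using orthogonal[of t] unfolding monic_orthogonal_polys_def by metis+

lemma coeff_P_eq_0: "t > 0 \<Longrightarrow> i > n \<Longrightarrow> coeff (P n t) i = 0"
  by (simp add: coeff_eq_0 degree_P)

lemma h_pos: "t > 0 \<Longrightarrow> h n t > 0"
  and L_P_P: "t > 0 \<Longrightarrow> j \<noteq> k \<Longrightarrow> L t (P j t * P k t) = 0"
proof -
  show "h n t > 0" if "t > 0"
    using orthogonal[OF that] unfolding monic_orthogonal_polys_def h_def weight_functional_def
    by (auto simp: poly_mult)
  show "L t (P j t * P k t) = 0" if "t > 0" "j \<noteq> k"
    using orthogonal[OF that(1)] that(2) unfolding monic_orthogonal_polys_def weight_functional_def
    by (auto simp: poly_mult)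
qed

text \<open>Subtracting \<open>coeff q m\<close> times \<open>P m t\<close> lowers the degree bound,
  and the removed term is orthogonal to \<open>P n t\<close> because m < n. Bounding coefficients
  instead of the degree makes the base case \<open>q = 0\<close>.\<close>

lemma L_P_lower_degree:
  assumes t: "t > 0"
  shows "m \<le> n \<Longrightarrow> (\<And>i. i \<ge> m \<Longrightarrow> coeff q i = 0) \<Longrightarrow> L t (P n t * q) = 0"
proof (induction m arbitrary: q)
  case 0
  then have "q = 0" by (simp add: poly_eq_iff)
  then show ?case using L_linear(3)[OF t, of 0 0] by simp
next
  case (Suc m)
  define r where "r = q - smult (coeff q m) (P m t)"
  have "coeff r i = 0" if "i \<ge> m" for i
    using that Suc.prems(2)[of i] t
    by (cases "i = m") (auto simp: r_def coeff_P_self coeff_P_eq_0)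
  then have "L t (P n t * r) = 0"
    using Suc by simp
  moreover have "P n t * r = P n t * q - smult (coeff q m) (P n t * P m t)"
    by (simp add: r_def algebra_simps)
  ultimately show ?case
    using L_P_P[OF t, of n m] Suc.prems by (simp add: L_linear[OF t])
qed

text \<open>Subtracting \<open>coeff q n\<close> times \<open>P n t\<close> leaves a polynomial of
  degree below n. All later integrals are evaluated by reading off a coefficient this way.\<close>

lemma L_P:
  assumes t: "t > 0" and q: "\<And>i. i > n \<Longrightarrow> coeff q i = 0"
  shows "L t (P n t * q) = coeff q n * h n t"
proof -
  define r where "r = q - smult (coeff q n) (P n t)"
  have "coeff r i = 0" if "i \<ge> n" for i
    using that q[of i] t by (cases "i = n") (auto simp: r_def coeff_P_self coeff_P_eq_0)
  then have "L t (P n t * r) = 0"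
    using L_P_lower_degree[OF t, of n n r] by simp
  moreover have "P n t * r = P n t * q - smult (coeff q n) (P n t * P n t)"
    by (simp add: r_def algebra_simps)
  ultimately show ?thesis
    by (simp add: L_linear[OF t] h_def)
qed

section \<open>Recurrence coefficients as quotients of integrals\<close>

lemma pCons_P:
  "t > 0 \<Longrightarrow> pCons 0 (P n t) = P (n + 1) t + smult (a n t) (P n t) + smult (b n t) (P (n - 1) t)"
  using recurrence[of t] by (simp add: recurrence_coeffs_def)

lemma P_0: "t > 0 \<Longrightarrow> P 0 t = 1" and b_0: "t > 0 \<Longrightarrow> b 0 t = 0"
  using recurrence[of t] by (simp_all add: recurrence_coeffs_def)

lemma a_eq:
  assumes t: "t > 0"
  shows "a n t = L t (pCons 0 (P n t * P n t)) / h n t"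
proof -
  have "pCons 0 (P n t * P n t) = P n t * pCons 0 (P n t)" by simp
  also have "\<dots> = P n t * P (n + 1) t + smult (a n t) (P n t * P n t) + smult (b n t) (P n t * P (n - 1) t)"
    unfolding pCons_P[OF t] by (simp add: algebra_simps)
  finally have "pCons 0 (P n t * P n t) = \<dots>" .
  \<comment> \<open>At \<open>n = 0\<close> the truncated index makes this integral the norm of
    \<open>P 0 t\<close>, which is not 0; there \<open>b 0 t = 0\<close> gives the claim.\<close>
  moreover have "b n t * L t (P n t * P (n - 1) t) = 0"
    using L_P_P[OF t, of n "n - 1"] b_0[OF t] by (cases "n = 0") auto
  ultimately have "L t (pCons 0 (P n t * P n t)) = a n t * h n t"
    using L_P_P[OF t, of n "n + 1"] by (simp add: L_linear[OF t] h_def)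
  then show ?thesis
    using h_pos[OF t, of n] by (simp add: field_simps)
qed

text \<open>The factor x is given to \<open>P n t\<close>, which becomes monic of degree
  n+1.\<close>

lemma L_pCons_P_P:
  assumes t: "t > 0"
  shows "L t (pCons 0 (P (Suc n) t * P n t)) = h (Suc n) t"
proof -
  have "pCons 0 (P (Suc n) t * P n t) = P (Suc n) t * pCons 0 (P n t)" by simp
  then show ?thesis
    using L_P[OF t, of "Suc n" "pCons 0 (P n t)"] t
    by (simp add: coeff_pCons coeff_P_self coeff_P_eq_0 split: nat.split)
qed

text \<open>The integral of \<open>L_pCons_P_P\<close> is evaluated a second time, with x given to
  \<open>P (Suc n) t\<close> and the recurrence applied.\<close>

lemma b_Suc_eq:
  assumes t: "t > 0"
  shows "b (Suc n) t = h (Suc n) t / h n t"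
proof -
  have "pCons 0 (P (Suc n) t * P n t) = P n t * pCons 0 (P (Suc n) t)" by (simp add: mult.commute)
  also have "\<dots> = P n t * P (Suc (Suc n)) t + smult (a (Suc n) t) (P n t * P (Suc n) t)
      + smult (b (Suc n) t) (P n t * P n t)"
    unfolding pCons_P[OF t] by (simp add: algebra_simps)
  finally have "pCons 0 (P (Suc n) t * P n t) = \<dots>" .
  then have "h (Suc n) t = b (Suc n) t * h n t"
    using L_P_P[OF t, of n "Suc n"] L_P_P[OF t, of n "Suc (Suc n)"] L_pCons_P_P[OF t, of n]
    by (simp add: L_linear[OF t] h_def)
  then show ?thesis
    using h_pos[OF t, of n] by (simp add: field_simps)
qed

text \<open>The derivative formula for P_n^2. Since P_n is monic, \<open>D\<close> has degree below
  n and its terms vanish; x (P_n^2)' contributes 2n \<open>h n t\<close> and x P_n^2 contributes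
  \<open>a n t * h n t\<close>.\<close>

lemma h_has_derivative:
  assumes t: "t > 0" and D: "has_coeff_derivative (P n) D t"
  shows "(h n has_real_derivative (2 * real n + 1 + \<alpha> - a n t) * h n t / t) (at t)"
proof -
  let ?p = "P n t"
  have D0: "coeff D i = 0" if "i \<ge> n" for i
    by (rule has_coeff_derivative_coeff_eq_0[OF D, of "{0<..}" i "if i = n then 1 else 0"])
       (use t that in \<open>auto simp: coeff_P_self coeff_P_eq_0\<close>)
  have "L t (?p * D + D * ?p) = 0"
    unfolding L_linear(1)[OF t] using L_P[OF t, of n D] D0 by (simp add: mult.commute)
  moreover have "L t (pCons 0 (pderiv (?p * ?p))) = 2 * real n * h n t"
  proof -
    have "pCons 0 (pderiv (?p * ?p)) = smult 2 (?p * pCons 0 (pderiv ?p))"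
      by (simp add: pderiv_mult numeral_poly)
    moreover have "L t (?p * pCons 0 (pderiv ?p)) = real n * h n t"
      using L_P[OF t, of n "pCons 0 (pderiv ?p)"] t
      by (simp add: coeff_pCons_pderiv coeff_P_self coeff_P_eq_0)
    ultimately show ?thesis by (simp only: L_linear[OF t])
  qed
  moreover have "L t (pCons 0 (?p * ?p)) = a n t * h n t"
    using a_eq[OF t, of n] h_pos[OF t, of n] by simp
  ultimately show ?thesis
    using weight_functional_has_derivative[OF alpha t has_coeff_derivative_mult[OF D D], of "2 * n"]
    by (simp add: degree_P degree_mult_eq_0 h_def[abs_def] algebra_simps order_trans[OF degree_mult_le])
qed

text \<open>Only existence is claimed, which suffices for the induction in
  \<open>P_differentiable\<close>; the value comes later from \<open>subleading\<close>.\<close>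

lemma a_differentiable:
  assumes t: "t > 0" and D: "has_coeff_derivative (P n) D t"
  shows "\<exists>a'. (a n has_real_derivative a') (at t)"
proof -
  note Q = has_coeff_derivative_pCons[OF has_coeff_derivative_mult[OF D D]]
  have "degree (pCons 0 (P n s * P n s)) \<le> Suc (n + n)" if "s > 0" for s
    using degree_mult_le[of "P n s" "P n s"] degree_P[OF that, of n]
    by (metis degree_pCons_le Suc_le_mono le_trans)
  from weight_functional_has_derivative[OF alpha t Q this]
  obtain c where c: "((\<lambda>s. L s (pCons 0 (P n s * P n s))) has_real_derivative c) (at t)"
    by blast
  have "\<exists>a'. ((\<lambda>s. L s (pCons 0 (P n s * P n s)) / h n s) has_real_derivative a') (at t)"
    using DERIV_divide[OF c h_has_derivative[OF t D]] h_pos[OF t, of n] by auto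
  then obtain a' where "((\<lambda>s. L s (pCons 0 (P n s * P n s)) / h n s) has_real_derivative a') (at t)"
    by blast
  then have "(a n has_real_derivative a') (at t)"
    by (rule has_field_derivative_transform_within_open[of _ _ _ "{0<..}"]) (use t a_eq in auto)
  then show ?thesis by blast
qed

text \<open>Logarithmic derivative of \<open>h (Suc n) / h n\<close>: the terms
  \<open>1 + \<alpha>\<close> cancel and the terms 2n leave the 2.\<close>

lemma b_Suc_has_derivative:
  assumes t: "t > 0" and D: "has_coeff_derivative (P (Suc n)) D t" and E: "has_coeff_derivative (P n) E t"
  shows "(b (Suc n) has_real_derivative b (Suc n) t * (a n t - a (Suc n) t + 2) / t) (at t)"
proof -
  have "((\<lambda>s. h (Suc n) s / h n s) has_real_derivative b (Suc n) t * (a n t - a (Suc n) t + 2) / t) (at t)"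
    using h_pos[OF t, of n] t
    by (auto intro!: derivative_eq_intros h_has_derivative[OF t D] h_has_derivative[OF t E]
        simp: b_Suc_eq[OF t] field_simps)
  then show ?thesis
    by (rule has_field_derivative_transform_within_open[of _ _ _ "{0<..}"]) (use t b_Suc_eq in auto)
qed

text \<open>Differentiability of P_m and P_(m-1) passes to a_m and b_m by the quotient formulas,
  then to P_(m+1) by the recurrence.\<close>

lemma P_differentiable:
  assumes t: "t > 0"
  shows "\<exists>D. has_coeff_derivative (P n) D t"
proof (induction n rule: less_induct)
  case (less n)
  show ?case
  proof (cases n)
    case 0
    show ?thesis
      using has_coeff_derivative_transform[OF has_coeff_derivative_const[of 1], of t "{0<..}" "P 0"] t 0
      by (auto simp: P_0)
  next
    case (Suc m)
    \<comment> \<open>For \<open>m = 0\<close> the second family is \<open>P 0\<close> again; it is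
      multiplied by \<open>b 0\<close>, which vanishes at positive times.\<close>
    obtain D E where D: "has_coeff_derivative (P m) D t" and E: "has_coeff_derivative (P (m - 1)) E t"
      using less[of m] less[of "m - 1"] Suc by fastforce
    obtain a' where a': "(a m has_real_derivative a') (at t)"
      using a_differentiable[OF t D] by blast
    obtain b' where b': "(b m has_real_derivative b') (at t)"
    proof (cases m)
      case 0
      have "((\<lambda>s. 0) has_real_derivative 0) (at t)" by simp
      then have "(b m has_real_derivative 0) (at t)"
        by (rule has_field_derivative_transform_within_open[of _ _ _ "{0<..}"])
           (use t b_0 0 in auto)
      then show ?thesis using that by blast
    next
      case (Suc k)
      then show ?thesis using b_Suc_has_derivative[OF t, of k D E] D E that by auto
    qed
    have "P n s = pCons 0 (P m s) - smult (a m s) (P m s) - smult (b m s) (P (m - 1) s)"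
      if "s > 0" for s
      using pCons_P[OF that, of m] Suc by simp
    then show ?thesis
      using has_coeff_derivative_transform[OF has_coeff_derivative_diff[OF has_coeff_derivative_diff[OF
            has_coeff_derivative_pCons[OF D] has_coeff_derivative_smult[OF a' D]]
            has_coeff_derivative_smult[OF b' E]], of "{0<..}" "P n"] t
      by auto
  qed
qed

section \<open>Subleading coefficients and the equation for a_n\<close>

definition subleading :: "nat \<Rightarrow> real \<Rightarrow> real" where
  "subleading n t = (if n = 0 then 0 else coeff (P n t) (n - 1))"

text \<open>Compare coefficients of x^n in the recurrence. Setting \<open>subleading 0\<close> to 0,
  where truncated subtraction would select the leading 1, makes the case \<open>n = 0\<close>
  fit.\<close>

lemma a_eq_subleading:
  assumes t: "t > 0"
  shows "a n t = subleading n t - subleading (Suc n) t"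
  using arg_cong[OF pCons_P[OF t, of n], of "\<lambda>p. coeff p n"] t
  by (cases n) (auto simp: subleading_def coeff_P_self coeff_P_eq_0 b_0)

text \<open>The integral of P_n P_(n-1) is 0 at all positive times. Its derivative, computed by
  \<open>weight_functional_has_derivative\<close>, gives a linear equation for
  \<open>coeff D m\<close>, the derivative sought.\<close>

lemma subleading_has_derivative:
  assumes t: "t > 0"
  shows "(subleading n has_real_derivative (subleading n t + b n t) / t) (at t)"
proof (cases n)
  case 0
  then show ?thesis using b_0[OF t] by (simp add: subleading_def[abs_def])
next
  case (Suc m)
  let ?p = "P n t" and ?q = "P m t"
  obtain D E where D: "has_coeff_derivative (P n) D t" and E: "has_coeff_derivative (P m) E t"
    using P_differentiable[OF t] by blast
  have D0: "coeff D i = 0" if "i > m" for i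
    by (rule has_coeff_derivative_coeff_eq_0[OF D, of "{0<..}" i "if i = n then 1 else 0"])
       (use t that Suc in \<open>auto simp: coeff_P_self coeff_P_eq_0\<close>)
  have E0: "coeff E i = 0" if "i \<ge> n" for i
    by (rule has_coeff_derivative_coeff_eq_0[OF E, of "{0<..}" i 0])
       (use t that Suc in \<open>auto simp: coeff_P_eq_0\<close>)
  have "((\<lambda>s. 0) has_real_derivative 0) (at t)" by simp
  then have zero: "((\<lambda>s. L s (P n s * P m s)) has_real_derivative 0) (at t)"
    by (rule has_field_derivative_transform_within_open[of _ _ _ "{0<..}"])
       (use t L_P_P[of _ n m] Suc in auto)
  have "degree (P n s * P m s) \<le> n + m" if "s > 0" for s
    using degree_mult_le[of "P n s" "P m s"] that by (simp add: degree_P)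
  from weight_functional_has_derivative[OF alpha t has_coeff_derivative_mult[OF D E] this]
  have deriv: "L t (?p * E + D * ?q) + (L t (pCons 0 (pderiv (?p * ?q)))
      + (1 + \<alpha>) * L t (?p * ?q) - L t (pCons 0 (?p * ?q))) / t = 0"
    using zero DERIV_unique by blast
  \<comment> \<open>\<open>E\<close> has degree below n, so its term vanishes; \<open>D\<close> has
    degree at most m, so pairing it with \<open>P m t\<close> extracts
    \<open>coeff D m\<close>.\<close>
  have 1: "L t (?p * E + D * ?q) = coeff D m * h m t"
    using L_P[OF t, of m D] D0 L_P[OF t, of n E] E0 by (simp add: L_linear[OF t] mult.commute)
  have 2: "L t (pCons 0 (pderiv (?p * ?q))) = - subleading n t * h m t"
  proof -
    \<comment> \<open>In x P_n' - n P_n the leading terms cancel, and the coefficient at m = n-1 is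
      minus the subleading one, so \<open>L_P\<close> applies with index m.\<close>
    define r where "r = pCons 0 (pderiv ?p) - smult (real n) ?p"
    have r: "coeff r i = (real i - real n) * coeff ?p i" for i
      by (simp add: r_def coeff_pCons_pderiv algebra_simps)
    have "coeff r i = 0" if "i > m" for i
      using that Suc t by (cases "i = n") (auto simp: r coeff_P_eq_0)
    then have "L t (?q * r) = - subleading n t * h m t"
      using L_P[OF t, of m r] Suc by (simp add: r subleading_def)
    moreover have "L t (?p * pCons 0 (pderiv ?q)) = 0"
      using L_P[OF t, of n "pCons 0 (pderiv ?q)"] Suc t coeff_pCons_pderiv[of ?q n]
      by (simp add: coeff_pCons_pderiv coeff_P_eq_0 del: coeff_pCons_Suc)
    moreover have "pCons 0 (pderiv (?p * ?q))
        = ?q * r + smult (real n) (?p * ?q) + ?p * pCons 0 (pderiv ?q)"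
      by (simp add: r_def pderiv_mult algebra_simps)
    ultimately show ?thesis
      using L_P_P[OF t, of n m] Suc by (simp add: L_linear[OF t])
  qed
  have 3: "L t (pCons 0 (?p * ?q)) = b n t * h m t"
    using L_pCons_P_P[OF t, of m] b_Suc_eq[OF t, of m] h_pos[OF t, of m] Suc by simp
  have "(t * coeff D m) * h m t = (subleading n t + b n t) * h m t"
    using deriv L_P_P[OF t, of n m] Suc t unfolding 1 2 3 by (simp add: field_simps)
  then have "t * coeff D m = subleading n t + b n t"
    using h_pos[OF t, of m] by (simp only: mult_right_cancel less_irrefl not_False_eq_True less_imp_neq[symmetric])
  then have "coeff D m = (subleading n t + b n t) / t"
    using t by (simp add: field_simps)
  moreover have "(subleading n has_real_derivative coeff D m) (at t)"
    using D Suc by (simp add: subleading_def[abs_def] has_coeff_derivative_def)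
  ultimately show ?thesis by simp
qed

text \<open>Difference of the subleading equations for n and n+1.\<close>

lemma a_has_derivative:
  assumes t: "t > 0"
  shows "(a n has_real_derivative (a n t + b n t - b (n + 1) t) / t) (at t)"
proof -
  have "((\<lambda>s. subleading n s - subleading (Suc n) s) has_real_derivative
      (a n t + b n t - b (n + 1) t) / t) (at t)"
    by (auto intro!: derivative_eq_intros subleading_has_derivative[OF t]
        simp: a_eq_subleading[OF t] diff_divide_distrib add_divide_distrib)
  then show ?thesis
    by (rule has_field_derivative_transform_within_open[of _ _ _ "{0<..}"])
       (use t a_eq_subleading in auto)
qed

lemma b_has_derivative:
  assumes "t > 0" "n \<ge> 1"
  shows "(b n has_real_derivative b n t * (a (n - 1) t - a n t + 2) / t) (at t)"
proof (cases n)
  case (Suc m)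
  obtain D E where "has_coeff_derivative (P (Suc m)) D t" "has_coeff_derivative (P m) E t"
    using P_differentiable[OF assms(1)] by blast
  from b_Suc_has_derivative[OF assms(1) this] show ?thesis
    using Suc by simp
qed (use assms in simp)

end

theorem theorem2p5:
  fixes \<alpha> :: real
    and P :: "nat \<Rightarrow> real \<Rightarrow> real poly"
    and a b :: "nat \<Rightarrow> real \<Rightarrow> real"
  assumes "\<alpha> > -1"
    and "\<And>t. t \<ge> 0 \<Longrightarrow> monic_orthogonal_polys \<alpha> t (\<lambda>n. P n t)"
    and "\<And>t. t \<ge> 0 \<Longrightarrow> recurrence_coeffs (\<lambda>n. P n t) (\<lambda>n. a n t) (\<lambda>n. b n t)"
  shows "\<forall>t>0.
      (\<forall>n. a n field_differentiable (at t) \<and>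
           t * deriv (a n) t = a n t + b n t - b (n + 1) t) \<and>
      (\<forall>n\<ge>1. b n field_differentiable (at t) \<and>
           t * deriv (b n) t = b n t * (a (n - 1) t - a n t + 2))"
proof -
  interpret recurrence_flow \<alpha> P a b
    by unfold_locales (use assms in auto)
  show ?thesis
    unfolding field_differentiable_def
  proof (intro allI impI conjI)
    fix t :: real and n :: nat
    assume t: "t > 0"
    show "\<exists>c. (a n has_real_derivative c) (at t)"
      using a_has_derivative[OF t] by blast
    show "t * deriv (a n) t = a n t + b n t - b (n + 1) t"
      using t by (simp add: DERIV_imp_deriv[OF a_has_derivative])
    assume n: "n \<ge> 1"
    show "\<exists>c. (b n has_real_derivative c) (at t)"
      using b_has_derivative[OF t n] by blast
    show "t * deriv (b n) t = b n t * (a (n - 1) t - a n t + 2)"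
      using t by (simp add: DERIV_imp_deriv[OF b_has_derivative[OF t n]])
  qed
qed

end
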